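(* Let $K$ be an irreducible, aperiodic, substochastic matrix on a countably infinite set $S$, with convergence norm $\rho$, and fix a state $x_0\in S$. Suppose that (i) for every $x\in S$ there is a probability distribution $\pi_x$ on $S$ (with $\pi_x(S)=1$) such that $\lim_{n\to\infty}K^n(x,y)/K^n(x,S)=\pi_x(y)$ for all $y\in S$; and (ii) (Jacka–Roberts condition) the limit $$\hat h(y)=\lim_{n\to\infty}\frac{K^n(y,S)}{K^n(x_0,S)}$$ exists for all $y\in S$. Then $K$ has the generalized strong ratio limit property, and $\hat h$ is $\rho$-superharmonic. If in addition the support of $K(x,\cdot)$ is finite for every $x\in S$, then $\hat h$ is $\rho$-harmonic.
   Context: A nonnegative matrix $K$ on $S$ is substochastic if $K(x,S)\le 1$ for all $x$, where $K(x,S)=\sum_{y\in S}K(x,y)$; $K^n$ is its $n$-th power and $K^n(x,S)=\sum_{y\in S}K^n(x,y)$. $K$ is irreducible if for all $x,y\in S$ there is $n$ with $K^n(x,y)>0$, and aperiodic if $\gcd\{n>0:K^n(x,x)>0\}=1$. The convergence parameter of $K$ is the radius of convergence $R$ of $\sum_{n\ge0}K^n(x,y)z^n$, which is the same for all $x,y$ when $K$ is irreducible and satisfies $1\le R<\infty$; the convergence norm is $\rho=1/R$. A $\rho$-invariant quasi-stationary distribution is a probability distribution $\pi$ on $S$ with $\pi(S)=1$ and $\pi K=\rho\pi$. Generalized strong ratio limit property: there exist a strictly positive constant $R$ (with $\rho=1/R$), a strictly positive function $h$ on $S$, and $\rho$-invariant quasi-stationary distributions $\pi_x$ on $S$ for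 every $x\in S$ such that $$\lim_{n\to\infty}\frac{K^{n+m}(u,v)}{K^n(x,y)}=R^{-m}\,\frac{h(u)\pi_u(v)}{h(x)\pi_x(y)}\quad\text{for all }u,v,x,y\in S\text{ and all }m\in\mathbb{Z}.$$ A function $h:S\to\mathbb{R}$ is $t$-superharmonic if $h\ge0$ and $Kh\le th$, where $(Kh)(x)=\sum_{y}K(x,y)h(y)$; it is $t$-harmonic if in addition $Kh=th$. *)

theory Defs
  imports "HOL-Probability.Probability"
begin

text \<open>
  Matrices on the state space are functions \<open>'s \<Rightarrow> 's \<Rightarrow> real\<close>; the state space is the whole type.
  Since \<open>infsum\<close> is 0 on families that are not summable, summability is demanded wherever
  a bound on a possibly divergent sum is stated.
\<close>

definition row_mass :: "('s \<Rightarrow> 's \<Rightarrow> real) \<Rightarrow> 's \<Rightarrow> real" where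
  "row_mass K x = (\<Sum>\<^sub>\<infinity>y. K x y)"

definition kernel_mult :: "('s \<Rightarrow> 's \<Rightarrow> real) \<Rightarrow> ('s \<Rightarrow> 's \<Rightarrow> real) \<Rightarrow> 's \<Rightarrow> 's \<Rightarrow> real" where
  "kernel_mult A B x y = (\<Sum>\<^sub>\<infinity>z. A x z * B z y)"

primrec kernel_pow :: "('s \<Rightarrow> 's \<Rightarrow> real) \<Rightarrow> nat \<Rightarrow> 's \<Rightarrow> 's \<Rightarrow> real" where
  "kernel_pow K 0 = (\<lambda>x y. if x = y then 1 else 0)"
| "kernel_pow K (Suc n) = kernel_mult K (kernel_pow K n)"

definition substochastic :: "('s \<Rightarrow> 's \<Rightarrow> real) \<Rightarrow> bool" where
  "substochastic K \<longleftrightarrow>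
     (\<forall>x y. 0 \<le> K x y) \<and> (\<forall>x. K x summable_on UNIV \<and> row_mass K x \<le> 1)"

definition irreducible_kernel :: "('s \<Rightarrow> 's \<Rightarrow> real) \<Rightarrow> bool" where
  "irreducible_kernel K \<longleftrightarrow> (\<forall>x y. \<exists>n. kernel_pow K n x y > 0)"

definition aperiodic_kernel :: "('s \<Rightarrow> 's \<Rightarrow> real) \<Rightarrow> bool" where
  "aperiodic_kernel K \<longleftrightarrow> (\<forall>x. Gcd {n::nat. n > 0 \<and> kernel_pow K n x x > 0} = 1)"

text \<open>
  The common radius of convergence of all the power series \<open>\<Sum>n. K\<^sup>n(x,y) z\<^sup>n\<close>; it exists and
  is finite for irreducible substochastic matrices on an infinite set, and is meaningful
  only when such a common finite radius exists.
\<close>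

definition convergence_parameter :: "('s \<Rightarrow> 's \<Rightarrow> real) \<Rightarrow> real" where
  "convergence_parameter K =
     (THE R. \<forall>x y. conv_radius (\<lambda>n. kernel_pow K n x y) = ereal R)"

definition convergence_norm :: "('s \<Rightarrow> 's \<Rightarrow> real) \<Rightarrow> real" where
  "convergence_norm K = 1 / convergence_parameter K"

definition invariant_qsd :: "('s \<Rightarrow> 's \<Rightarrow> real) \<Rightarrow> real \<Rightarrow> 's pmf \<Rightarrow> bool" where
  "invariant_qsd K \<rho> \<pi> \<longleftrightarrow> (\<forall>y. ((\<lambda>x. pmf \<pi> x * K x y) has_sum (\<rho> * pmf \<pi> y)) UNIV)"

text \<open>
  The integer shift \<open>m\<close> may be negative; \<open>nat (int n + m)\<close> is the intended exponent as soon
  as \<open>n \<ge> -m\<close>, and the earlier terms do not affect the limit.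
\<close>

definition generalized_SRLP :: "('s \<Rightarrow> 's \<Rightarrow> real) \<Rightarrow> bool" where
  "generalized_SRLP K \<longleftrightarrow>
     (\<exists>(R::real) (h :: 's \<Rightarrow> real) (\<pi> :: 's \<Rightarrow> 's pmf).
        R > 0 \<and> convergence_norm K = 1 / R \<and> (\<forall>x. h x > 0) \<and>
        (\<forall>x. invariant_qsd K (1 / R) (\<pi> x)) \<and>
        (\<forall>u v x y. \<forall>m::int.
           (\<lambda>n. kernel_pow K (nat (int n + m)) u v / kernel_pow K n x y)
             \<longlonglongrightarrow> R powi (- m) * ((h u * pmf (\<pi> u) v) / (h x * pmf (\<pi> x) y))))"

definition superharmonic :: "('s \<Rightarrow> 's \<Rightarrow> real) \<Rightarrow> real \<Rightarrow> ('s \<Rightarrow> real) \<Rightarrow> bool" where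
  "superharmonic K t h \<longleftrightarrow> (\<forall>x. 0 \<le> h x) \<and>
     (\<forall>x. (\<lambda>y. K x y * h y) summable_on UNIV \<and> (\<Sum>\<^sub>\<infinity>y. K x y * h y) \<le> t * h x)"

definition harmonic :: "('s \<Rightarrow> 's \<Rightarrow> real) \<Rightarrow> real \<Rightarrow> ('s \<Rightarrow> real) \<Rightarrow> bool" where
  "harmonic K t h \<longleftrightarrow> superharmonic K t h \<and> (\<forall>x. (\<Sum>\<^sub>\<infinity>y. K x y * h y) = t * h x)"

end

theory Submission
  imports Defs
begin

text \<open>
  By Scheffe's lemma the pointwise convergence of \<open>K\<^sup>n(x,\<cdot>) / K\<^sup>n(x,S)\<close> to \<open>\<pi>\<^sub>x\<close> holds in total
  variation, so it may be integrated against the bounded functions \<open>K(\<cdot>,S)\<close> and \<open>K(\<cdot>,y)\<close>. The first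
  gives \<open>K\<^sup>n\<^sup>+\<^sup>1(x,S) / K\<^sup>n(x,S) \<longlonglongrightarrow> \<lambda>\<^sub>x = \<pi>\<^sub>xK(S)\<close>, the second then \<open>\<pi>\<^sub>xK = \<lambda>\<^sub>x\<pi>\<^sub>x\<close>; by irreducibility
  \<open>\<pi>\<^sub>x > 0\<close>. Irreducibility also makes the Jacka--Roberts limits positive, which forces all \<open>\<lambda>\<^sub>x\<close> to
  equal one \<open>\<lambda>\<close>. Factoring the ratios \<open>K\<^sup>n\<^sup>+\<^sup>m(u,v) / K\<^sup>n(x,y)\<close> through row masses gives the ratio limits,
  and the ratio test identifies \<open>\<lambda>\<close> with \<open>\<rho>\<close>. Superharmonicity is Fatou's lemma applied to
  \<open>K\<^sup>n\<^sup>+\<^sup>1(x,S) = \<Sum>\<^sub>y K(x,y) K\<^sup>n(y,S)\<close>; for finitely supported rows the limit passes inside the sum.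
\<close>

section \<open>Sums of nonnegative families: Fatou, Scheffe, Tonelli\<close>

lemma pmf_has_sum_1: "(pmf p has_sum 1) UNIV"
proof -
  have "infsum (pmf p) UNIV = 1"
    using infsetsum_infsum[OF pmf_abs_summable[of p UNIV]] infsetsum_pmf_eq_1[of p UNIV] by simp
  moreover have "pmf p summable_on UNIV"
    using pmf_abs_summable[of p UNIV]
    by (metis abs_summable_equivalent abs_summable_summable)
  ultimately show ?thesis
    by (metis has_sum_infsum)
qed

text \<open>Fatou's lemma for sums: a finite partial sum of \<open>g\<close> already exceeds
  \<open>a\<close>, finite sums pass to the limit, and nonnegativity bounds them by the full
  sums.\<close>

lemma eventually_less_infsum_limit:
  fixes f :: "nat \<Rightarrow> 'a \<Rightarrow> real"
  assumes "\<And>n z. 0 \<le> f n z" and "\<And>n. f n summable_on UNIV"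
    and "\<And>z. (\<lambda>n. f n z) \<longlonglongrightarrow> g z" and "g summable_on UNIV" and "a < infsum g UNIV"
  shows "eventually (\<lambda>n. a < infsum (f n) UNIV) sequentially"
proof -
  obtain F where F: "finite F" "a < sum g F"
    using infsum_le_finite_sums[OF assms(4), of a] assms(5) by force
  have "(\<lambda>n. sum (f n) F) \<longlonglongrightarrow> sum g F"
    by (intro tendsto_sum assms(3))
  from order_tendstoD(1)[OF this F(2)] show ?thesis
  proof eventually_elim
    case (elim n)
    also have "sum (f n) F \<le> infsum (f n) UNIV"
      by (intro finite_sum_le_infsum assms F) auto
    finally show ?case .
  qed
qed

lemma summable_on_mult_bounded:
  fixes f g :: "'a \<Rightarrow> real"
  assumes "f summable_on UNIV" and "\<And>z. 0 \<le> f z" and "\<And>z. 0 \<le> g z" and "\<And>z. g z \<le> 1"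
  shows "(\<lambda>z. f z * g z) summable_on UNIV"
  by (rule summable_on_comparison_test[OF assms(1)]) (auto simp: assms mult_left_le)

text \<open>Scheffe's lemma: the lower bound is applied both to \<open>g\<close> and to \<open>1 - g\<close>.\<close>

lemma tendsto_infsum_mult_bounded:
  fixes p :: "nat \<Rightarrow> 'a \<Rightarrow> real" and q :: "'a \<Rightarrow> real"
  assumes p: "\<And>n z. 0 \<le> p n z" "\<And>n. (p n has_sum 1) UNIV"
    and q: "\<And>z. 0 \<le> q z" "(q has_sum 1) UNIV"
    and lim: "\<And>z. (\<lambda>n. p n z) \<longlonglongrightarrow> q z"
    and g: "\<And>z. 0 \<le> g z" "\<And>z. g z \<le> 1"
  shows "(\<lambda>n. \<Sum>\<^sub>\<infinity>z. p n z * g z) \<longlonglongrightarrow> (\<Sum>\<^sub>\<infinity>z. q z * g z)"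
proof -
  have sp: "p n summable_on UNIV" for n using p(2) summable_on_def by blast
  have sq: "q summable_on UNIV" using q(2) summable_on_def by blast
  have lower: "eventually (\<lambda>n. a < (\<Sum>\<^sub>\<infinity>z. p n z * k z)) sequentially"
    if "a < (\<Sum>\<^sub>\<infinity>z. q z * k z)" "\<And>z. 0 \<le> k z" "\<And>z. k z \<le> 1" for a and k :: "'a \<Rightarrow> real"
    by (rule eventually_less_infsum_limit[OF _ _ _ _ that(1)])
      (auto intro!: summable_on_mult_bounded mult_nonneg_nonneg tendsto_intros lim sp sq that p q)
  \<comment> \<open>Unit mass of both \<open>p n\<close> and \<open>q\<close> enters here: since no
    mass escapes in the limit, a lower bound for \<open>1 - g\<close> becomes an upper bound for
    \<open>g\<close>.\<close>
  have compl: "(\<Sum>\<^sub>\<infinity>z. r z * (1 - g z)) = 1 - (\<Sum>\<^sub>\<infinity>z. r z * g z)"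
    if "\<And>z. 0 \<le> r z" "(r has_sum 1) UNIV" for r :: "'a \<Rightarrow> real"
  proof -
    have "(\<lambda>z. r z * g z) summable_on UNIV"
      using that by (intro summable_on_mult_bounded g) (auto simp: summable_on_def)
    then have "((\<lambda>z. r z + - (r z * g z)) has_sum (1 + - (\<Sum>\<^sub>\<infinity>z. r z * g z))) UNIV"
      by (intro has_sum_add that has_sum_uminusI has_sum_infsum)
    then show ?thesis
      by (intro infsumI) (simp add: algebra_simps)
  qed
  show ?thesis
  proof (rule order_tendstoI)
    fix a assume "a < (\<Sum>\<^sub>\<infinity>z. q z * g z)"
    then show "eventually (\<lambda>n. a < (\<Sum>\<^sub>\<infinity>z. p n z * g z)) sequentially"
      by (rule lower) (use g in auto)
  next
    fix a assume "a > (\<Sum>\<^sub>\<infinity>z. q z * g z)"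
    then have "1 - a < (\<Sum>\<^sub>\<infinity>z. q z * (1 - g z))"
      using compl[OF q] by simp
    then have "eventually (\<lambda>n. 1 - a < (\<Sum>\<^sub>\<infinity>z. p n z * (1 - g z))) sequentially"
      by (rule lower) (use g in auto)
    then show "eventually (\<lambda>n. (\<Sum>\<^sub>\<infinity>z. p n z * g z) < a) sequentially"
      using compl[OF p] by (auto elim: eventually_mono)
  qed
qed

text \<open>Tonelli for a mixture of the rows \<open>g w\<close> with weights \<open>f w\<close>.
  The bound 1 on the row sums lets \<open>f\<close> dominate them, so the double family is summable
  and the order of summation may be exchanged.\<close>

lemma
  fixes f :: "'a \<Rightarrow> real" and g :: "'a \<Rightarrow> 'b \<Rightarrow> real"
  assumes f: "\<And>w. 0 \<le> f w" "f summable_on UNIV"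
    and g: "\<And>w z. 0 \<le> g w z" "\<And>w. g w summable_on UNIV" "\<And>w. infsum (g w) UNIV \<le> 1"
  shows infsum_mixture: "(\<Sum>\<^sub>\<infinity>z. \<Sum>\<^sub>\<infinity>w. f w * g w z) = (\<Sum>\<^sub>\<infinity>w. f w * infsum (g w) UNIV)"
    and summable_on_mixture: "(\<lambda>z. \<Sum>\<^sub>\<infinity>w. f w * g w z) summable_on UNIV"
proof -
  have "(\<lambda>(w, z). f w * g w z) summable_on (UNIV \<times> UNIV)"
  proof (rule summable_on_SigmaI[where g = "\<lambda>w. f w * infsum (g w) UNIV"])
    show "((\<lambda>z. case (w, z) of (w, z) \<Rightarrow> f w * g w z) has_sum f w * infsum (g w) UNIV) UNIV" for w
      using has_sum_cmult_right[OF has_sum_infsum[OF g(2)[of w]], of "f w"] by simp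
    show "(\<lambda>w. f w * infsum (g w) UNIV) summable_on UNIV"
      by (intro summable_on_mult_bounded f g infsum_nonneg)
  qed (use f g in auto)
  then have sum: "(\<lambda>(w, z). f w * g w z) summable_on (UNIV \<times> UNIV)" .
  have "(\<Sum>\<^sub>\<infinity>z. \<Sum>\<^sub>\<infinity>w. f w * g w z) = (\<Sum>\<^sub>\<infinity>w. \<Sum>\<^sub>\<infinity>z. f w * g w z)"
    by (rule infsum_swap_banach[OF sum, symmetric])
  then show "(\<Sum>\<^sub>\<infinity>z. \<Sum>\<^sub>\<infinity>w. f w * g w z) = (\<Sum>\<^sub>\<infinity>w. f w * infsum (g w) UNIV)"
    by (simp add: infsum_cmult_right')
  have "(\<lambda>(z, w). f w * g w z) summable_on (UNIV \<times> UNIV)"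
    using sum by (subst summable_on_swap) simp
  then show "(\<lambda>z. \<Sum>\<^sub>\<infinity>w. f w * g w z) summable_on UNIV"
    by (rule summable_on_Sigma_banach)
qed

section \<open>Substochastic matrices and their powers\<close>

lemma
  assumes "substochastic A"
  shows substochastic_nonneg: "0 \<le> A x y"
    and substochastic_summable: "A x summable_on UNIV"
    and substochastic_mass_le_1: "row_mass A x \<le> 1"
  using assms by (auto simp: substochastic_def)

lemma row_mass_nonneg: "substochastic A \<Longrightarrow> 0 \<le> row_mass A x"
  unfolding row_mass_def by (intro infsum_nonneg substochastic_nonneg)

lemma substochastic_le_1:
  assumes "substochastic A"
  shows "A x y \<le> 1"
proof -
  have "sum (A x) {y} \<le> row_mass A x"
    unfolding row_mass_def
    by (rule finite_sum_le_infsum) (auto simp: assms substochastic_summable substochastic_nonneg)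
  then show ?thesis
    using substochastic_mass_le_1[OF assms, of x] by simp
qed

lemma row_mass_kernel_mult:
  assumes "substochastic A" "substochastic B"
  shows "row_mass (kernel_mult A B) x = (\<Sum>\<^sub>\<infinity>z. A x z * row_mass B z)"
  unfolding row_mass_def kernel_mult_def using assms
  by (intro infsum_mixture) (auto simp: substochastic_def row_mass_def)

lemma substochastic_kernel_mult:
  assumes A: "substochastic A" and B: "substochastic B"
  shows "substochastic (kernel_mult A B)"
  unfolding substochastic_def
proof (intro conjI allI)
  show "0 \<le> kernel_mult A B x y" for x y
    unfolding kernel_mult_def
    by (intro infsum_nonneg mult_nonneg_nonneg substochastic_nonneg assms)
  show "kernel_mult A B x summable_on UNIV" for x
    unfolding kernel_mult_def using assms
    by (intro summable_on_mixture) (auto simp: substochastic_def row_mass_def)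
  have "(\<Sum>\<^sub>\<infinity>z. A x z * row_mass B z) \<le> row_mass A x" for x
    unfolding row_mass_def[of A]
    by (intro infsum_mono summable_on_mult_bounded mult_left_le)
      (auto simp: assms substochastic_nonneg substochastic_summable
          substochastic_mass_le_1 row_mass_nonneg)
  then show "row_mass (kernel_mult A B) x \<le> 1" for x
    using substochastic_mass_le_1[OF A, of x]
    by (simp add: row_mass_kernel_mult[OF assms]) (rule order_trans)
qed

text \<open>For fixed \<open>x\<close> and \<open>y\<close> this is an exchange of sums; the inner
  sums are entries of \<open>kernel_mult B C\<close>, hence at most 1, as the mixture lemma
  requires.\<close>

lemma kernel_mult_assoc:
  assumes "substochastic A" "substochastic B" "substochastic C"
  shows "kernel_mult (kernel_mult A B) C = kernel_mult A (kernel_mult B C)"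
proof (intro ext)
  fix x y
  have sB: "(\<lambda>z. B w z * C z y) summable_on UNIV" for w
    by (intro summable_on_mult_bounded)
      (auto simp: assms substochastic_nonneg substochastic_summable substochastic_le_1)
  have le: "(\<Sum>\<^sub>\<infinity>z. B w z * C z y) \<le> 1" for w
    using substochastic_le_1[OF substochastic_kernel_mult[OF assms(2,3)], of w y]
    by (simp add: kernel_mult_def)
  have "(\<Sum>\<^sub>\<infinity>z. \<Sum>\<^sub>\<infinity>w. A x w * (B w z * C z y)) = (\<Sum>\<^sub>\<infinity>w. A x w * (\<Sum>\<^sub>\<infinity>z. B w z * C z y))"
    by (intro infsum_mixture)
      (auto simp: assms substochastic_nonneg substochastic_summable sB le)
  moreover have "(\<Sum>\<^sub>\<infinity>w. A x w * (B w z * C z y)) = (\<Sum>\<^sub>\<infinity>w. A x w * B w z) * C z y" for z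
    by (subst infsum_cmult_left'[symmetric]) (simp add: mult.assoc)
  ultimately show "kernel_mult (kernel_mult A B) C x y = kernel_mult A (kernel_mult B C) x y"
    by (simp add: kernel_mult_def)
qed

lemma has_sum_identity_row: "((\<lambda>y. if x = y then 1 else 0 :: real) has_sum 1) UNIV"
  by (rule has_sum_finite_neutralI[where B = "{x}"]) auto

lemma substochastic_kernel_pow:
  assumes "substochastic K"
  shows "substochastic (kernel_pow K n)"
proof (induction n)
  case 0
  have "(\<lambda>y. if x = y then 1 else 0 :: real) summable_on UNIV" for x :: 'a
    using has_sum_identity_row by (rule has_sum_imp_summable)
  moreover have "(\<Sum>\<^sub>\<infinity>y. if x = y then 1 else 0 :: real) = 1" for x :: 'a
    using has_sum_identity_row by (rule infsumI)
  ultimately show ?case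
    by (simp add: substochastic_def row_mass_def)
qed (simp add: substochastic_kernel_mult assms)

lemma kernel_mult_identity: "kernel_mult (\<lambda>x y. if x = y then 1 else 0) B = B"
proof (intro ext)
  fix x y
  have "((\<lambda>z. (if x = z then 1 else 0) * B z y) has_sum B x y) UNIV"
    by (rule has_sum_finite_neutralI[where B = "{x}"]) auto
  then show "kernel_mult (\<lambda>x y. if x = y then 1 else 0) B x y = B x y"
    unfolding kernel_mult_def by (rule infsumI)
qed

lemma kernel_pow_add:
  assumes "substochastic K"
  shows "kernel_pow K (m + n) = kernel_mult (kernel_pow K m) (kernel_pow K n)"
  by (induction m)
    (simp_all add: kernel_mult_identity kernel_mult_assoc assms substochastic_kernel_pow)

lemma row_mass_kernel_pow_add:
  assumes "substochastic K"
  shows "row_mass (kernel_pow K (m + n)) x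
    = (\<Sum>\<^sub>\<infinity>z. kernel_pow K m x z * row_mass (kernel_pow K n) z)"
  by (simp add: kernel_pow_add row_mass_kernel_mult substochastic_kernel_pow assms)

lemma term_le_row_mass_kernel_pow_add:
  assumes "substochastic K"
  shows "kernel_pow K m x z * row_mass (kernel_pow K n) z \<le> row_mass (kernel_pow K (m + n)) x"
proof -
  note K = substochastic_kernel_pow[OF assms]
  have "(\<Sum>z\<in>{z}. kernel_pow K m x z * row_mass (kernel_pow K n) z)
    \<le> (\<Sum>\<^sub>\<infinity>z. kernel_pow K m x z * row_mass (kernel_pow K n) z)"
    by (intro finite_sum_le_infsum summable_on_mult_bounded)
      (auto simp: K substochastic_nonneg substochastic_summable
        substochastic_mass_le_1 row_mass_nonneg)
  then show ?thesis
    by (simp add: row_mass_kernel_pow_add assms)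
qed

text \<open>Splitting after \<open>m\<close> steps weights row \<open>x\<close> of the
  \<open>m\<close>-th power by masses that are at most 1.\<close>

lemma row_mass_kernel_pow_antimono:
  assumes "substochastic K"
  shows "row_mass (kernel_pow K (m + n)) x \<le> row_mass (kernel_pow K m) x"
proof -
  note K = substochastic_kernel_pow[OF assms]
  have "(\<Sum>\<^sub>\<infinity>z. kernel_pow K m x z * row_mass (kernel_pow K n) z) \<le> (\<Sum>\<^sub>\<infinity>z. kernel_pow K m x z)"
    by (intro infsum_mono summable_on_mult_bounded mult_left_le)
      (auto simp: K substochastic_nonneg substochastic_summable
        substochastic_mass_le_1 row_mass_nonneg)
  then show ?thesis
    by (simp add: row_mass_kernel_pow_add assms) (simp add: row_mass_def)
qed

lemma kernel_pow_1:
  assumes "substochastic K"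
  shows "kernel_pow K 1 = K"
proof (intro ext)
  fix x y
  have "((\<lambda>z. K x z * (if z = y then 1 else 0)) has_sum K x y) UNIV"
    by (rule has_sum_finite_neutralI[where B = "{y}"]) auto
  then show "kernel_pow K 1 x y = K x y"
    by (simp add: kernel_mult_def infsumI)
qed

section \<open>Positivity of row masses\<close>

lemma infsum_pos_nonneg_real:
  fixes f :: "'a \<Rightarrow> real"
  assumes "f summable_on UNIV" and "\<And>z. 0 \<le> f z" and "0 < f z"
  shows "0 < infsum f UNIV"
  using nonneg_infsum_le_0D[OF _ assms(1), of z] assms(2,3) by force

text \<open>An infinite state space excludes the zero matrix on a single point, which is vacuously
  irreducible because \<open>kernel_pow K 0\<close> is the identity.\<close>

lemma row_mass_kernel_pow_pos:
  fixes K :: "'s \<Rightarrow> 's \<Rightarrow> real"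
  assumes "infinite (UNIV :: 's set)" "substochastic K" "irreducible_kernel K"
  shows "0 < row_mass (kernel_pow K n) x"
proof (induction n arbitrary: x)
  case 0
  show ?case
    using has_sum_identity_row[of x] by (simp add: row_mass_def infsumI)
next
  case (Suc n)
  note K = substochastic_kernel_pow[OF assms(2)]
  \<comment> \<open>Going from \<open>x\<close> to another state takes at least one step. A zero row
    of \<open>K\<close> at \<open>x\<close> would make every entry of that row vanish in all
    positive powers.\<close>
  obtain y where "x \<noteq> y"
    using assms(1) by (metis (full_types) UNIV_eq_I finite.simps singletonI)
  obtain m where m: "0 < kernel_pow K m x y"
    using assms(3) by (auto simp: irreducible_kernel_def)
  obtain m' where "m = Suc m'"
    using m \<open>x \<noteq> y\<close> by (cases m) auto
  then have "\<exists>z. K x z \<noteq> 0"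
    using m by (intro not_all[THEN iffD1] notI) (simp add: kernel_mult_def)
  then obtain z where "0 < K x z"
    using substochastic_nonneg[OF assms(2), of x] by (metis order_le_less)
  then have "0 < kernel_pow K 1 x z * row_mass (kernel_pow K n) z"
    using Suc.IH by (simp only: kernel_pow_1[OF assms(2)] mult_pos_pos)
  also have "\<dots> \<le> row_mass (kernel_pow K (1 + n)) x"
    by (rule term_le_row_mass_kernel_pow_add[OF assms(2)])
  finally show ?case by simp
qed

section \<open>Limiting conditional distributions are quasi-stationary\<close>

lemma row_distribution_has_sum_1:
  assumes "substochastic A" "0 < row_mass A x"
  shows "((\<lambda>y. A x y / row_mass A x) has_sum 1) UNIV"
proof -
  have "(A x has_sum row_mass A x) UNIV"
    unfolding row_mass_def by (intro has_sum_infsum substochastic_summable assms)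
  from has_sum_cmult_left[OF this, of "1 / row_mass A x"] show ?thesis
    using assms(2) by simp
qed

text \<open>Only one starting state \<open>x\<close> is considered, so at this stage
  \<open>l\<close> may depend on \<open>x\<close>.\<close>

lemma yaglom_limit:
  fixes K :: "'s \<Rightarrow> 's \<Rightarrow> real" and \<pi> :: "'s pmf"
  assumes inf: "infinite (UNIV :: 's set)" and sub: "substochastic K"
    and irr: "irreducible_kernel K"
    and lim: "\<And>y. (\<lambda>n. kernel_pow K n x y / row_mass (kernel_pow K n) x) \<longlonglongrightarrow> pmf \<pi> y"
  obtains l where "0 < l"
    and "(\<lambda>n. row_mass (kernel_pow K (Suc n)) x / row_mass (kernel_pow K n) x) \<longlonglongrightarrow> l"
    and "invariant_qsd K l \<pi>" and "\<And>y. 0 < pmf \<pi> y"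
proof -
  note K = substochastic_kernel_pow[OF sub]
  note pos = row_mass_kernel_pow_pos[OF inf sub irr]
  let ?S = "\<lambda>n. row_mass (kernel_pow K n) x"
  have average: "(\<lambda>n. (\<Sum>\<^sub>\<infinity>z. kernel_pow K n x z * g z) / ?S n) \<longlonglongrightarrow> (\<Sum>\<^sub>\<infinity>z. pmf \<pi> z * g z)"
    if g: "\<And>z. 0 \<le> g z" "\<And>z. g z \<le> 1" for g :: "'s \<Rightarrow> real"
  proof -
    have "(\<lambda>n. \<Sum>\<^sub>\<infinity>z. kernel_pow K n x z / ?S n * g z) \<longlonglongrightarrow> (\<Sum>\<^sub>\<infinity>z. pmf \<pi> z * g z)"
      by (rule tendsto_infsum_mult_bounded)
        (auto intro!: lim g row_distribution_has_sum_1 K pos pmf_has_sum_1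
          divide_nonneg_pos substochastic_nonneg[OF K])
    moreover have "(\<Sum>\<^sub>\<infinity>z. kernel_pow K n x z / ?S n * g z)
      = (\<Sum>\<^sub>\<infinity>z. kernel_pow K n x z * g z) / ?S n" for n
      using infsum_cmult_right'[of "1 / ?S n" "\<lambda>z. kernel_pow K n x z * g z" UNIV] by simp
    ultimately show ?thesis by simp
  qed
  \<comment> \<open>The mass of \<open>\<pi>\<close> after one application of \<open>K\<close>, that
    is, the one-step survival probability from \<open>\<pi>\<close>.\<close>
  define l where "l = (\<Sum>\<^sub>\<infinity>z. pmf \<pi> z * row_mass K z)"
  have sum_pi: "(\<lambda>z. pmf \<pi> z * g z) summable_on UNIV"
    if "\<And>z. 0 \<le> g z" "\<And>z. g z \<le> 1" for g
    using pmf_has_sum_1[of \<pi>] that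
    by (intro summable_on_mult_bounded) (auto simp: summable_on_def)
  obtain z0 where z0: "z0 \<in> set_pmf \<pi>"
    using set_pmf_not_empty[of \<pi>] by blast
  have "0 < l"
    unfolding l_def
  proof (rule infsum_pos_nonneg_real)
    show "0 < pmf \<pi> z0 * row_mass K z0"
      using pos[of 1 z0] z0 by (simp only: kernel_pow_1[OF sub] pmf_positive mult_pos_pos)
  qed (auto intro!: sum_pi mult_nonneg_nonneg row_mass_nonneg substochastic_mass_le_1 sub)
  have rate: "(\<lambda>n. ?S (Suc n) / ?S n) \<longlonglongrightarrow> l"
  proof -
    have "(\<Sum>\<^sub>\<infinity>z. kernel_pow K n x z * row_mass K z) = ?S (Suc n)" for n
      using row_mass_kernel_pow_add[OF sub, of n 1 x]
      unfolding kernel_pow_1[OF sub] by (simp del: kernel_pow.simps)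
    then show ?thesis
      unfolding l_def
      using average[of "row_mass K"] by (simp add: row_mass_nonneg substochastic_mass_le_1 sub)
  qed
  \<comment> \<open>The limit of \<open>kernel_pow K (Suc n) x y / ?S n\<close> is computed twice:
    by averaging column \<open>y\<close> of \<open>K\<close>, and by normalising with
    \<open>?S (Suc n)\<close> and multiplying by the rate.\<close>
  have eigen: "(\<Sum>\<^sub>\<infinity>z. pmf \<pi> z * K z y) = l * pmf \<pi> y" for y
  proof -
    have "(\<Sum>\<^sub>\<infinity>z. kernel_pow K n x z * K z y) = kernel_pow K (Suc n) x y" for n
      using kernel_pow_add[OF sub, of n 1]
      unfolding kernel_pow_1[OF sub] by (simp del: kernel_pow.simps add: kernel_mult_def)
    then have "(\<lambda>n. kernel_pow K (Suc n) x y / ?S n) \<longlonglongrightarrow> (\<Sum>\<^sub>\<infinity>z. pmf \<pi> z * K z y)"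
      using average[of "\<lambda>z. K z y"] by (simp add: substochastic_nonneg substochastic_le_1 sub)
    moreover have "(\<lambda>n. kernel_pow K (Suc n) x y / ?S (Suc n) * (?S (Suc n) / ?S n))
      \<longlonglongrightarrow> pmf \<pi> y * l"
      by (intro tendsto_mult rate LIMSEQ_Suc[OF lim])
    moreover have "kernel_pow K (Suc n) x y / ?S (Suc n) * (?S (Suc n) / ?S n)
      = kernel_pow K (Suc n) x y / ?S n" for n
      using pos[of "Suc n" x] by (simp del: kernel_pow.simps)
    ultimately show ?thesis
      by (simp add: LIMSEQ_unique mult.commute del: kernel_pow.simps)
  qed
  have qsd: "invariant_qsd K l \<pi>"
    unfolding invariant_qsd_def
    by (auto simp: eigen[symmetric] substochastic_nonneg substochastic_le_1 sub
        intro!: has_sum_infsum sum_pi)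
  have eigen_pow: "(\<Sum>\<^sub>\<infinity>z. pmf \<pi> z * kernel_pow K n z y) = l ^ n * pmf \<pi> y" for n y
  proof (induction n arbitrary: y)
    case 0
    have "((\<lambda>z. pmf \<pi> z * (if z = y then 1 else 0)) has_sum pmf \<pi> y) UNIV"
      by (rule has_sum_finite_neutralI[where B = "{y}"]) auto
    then show ?case by (simp add: infsumI)
  next
    case (Suc n)
    \<comment> \<open>A matrix with all rows equal to \<open>\<pi>\<close> turns the action on a row
      vector into a matrix product, so associativity applies.\<close>
    let ?A = "\<lambda>_ z. pmf \<pi> z"
    have "substochastic ?A"
      using pmf_has_sum_1[of \<pi>]
      by (auto simp: substochastic_def row_mass_def summable_on_def dest: infsumI)
    then have "kernel_mult ?A (kernel_mult K (kernel_pow K n)) x y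
      = kernel_mult (kernel_mult ?A K) (kernel_pow K n) x y"
      by (simp add: kernel_mult_assoc sub K)
    then have "(\<Sum>\<^sub>\<infinity>z. pmf \<pi> z * kernel_pow K (Suc n) z y)
      = (\<Sum>\<^sub>\<infinity>z. l * (pmf \<pi> z * kernel_pow K n z y))"
      by (simp add: kernel_mult_def eigen mult.assoc)
    then show ?case
      by (simp only: infsum_cmult_right' Suc.IH) simp
  qed
  \<comment> \<open>Some power of \<open>K\<close> leads from the support point \<open>z0\<close> to
    \<open>y\<close>, and invariance under that power transfers the positivity to
    \<open>y\<close>.\<close>
  have "0 < pmf \<pi> y" for y
  proof -
    obtain n where "0 < kernel_pow K n z0 y"
      using irr by (auto simp: irreducible_kernel_def)
    then have "0 < (\<Sum>\<^sub>\<infinity>z. pmf \<pi> z * kernel_pow K n z y)"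
      using z0 by (intro infsum_pos_nonneg_real[where z = z0] sum_pi)
        (auto simp: K substochastic_nonneg substochastic_le_1 pmf_positive)
    then show ?thesis
      using \<open>0 < l\<close> by (simp add: eigen_pow zero_less_mult_iff)
  qed
  with \<open>0 < l\<close> rate qsd show thesis by (rule that)
qed

section \<open>Limits of shifted ratios and of survival ratios\<close>

text \<open>Forward shifts telescope into consecutive ratios; backward shifts are reciprocals of
  forward ones.\<close>

lemma tendsto_ratio_shift:
  fixes s :: "nat \<Rightarrow> real"
  assumes pos: "\<And>n. 0 < s n" and lim: "(\<lambda>n. s (Suc n) / s n) \<longlonglongrightarrow> l" and "0 < l"
  shows "(\<lambda>n. s (nat (int n + m)) / s n) \<longlonglongrightarrow> l powi m"
proof -
  have nz: "s n \<noteq> 0" for n using pos[of n] by simp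
  have fwd: "(\<lambda>n. s (n + k) / s n) \<longlonglongrightarrow> l ^ k" for k
  proof (induction k)
    case (Suc k)
    have "(\<lambda>n. s (Suc (n + k)) / s (n + k) * (s (n + k) / s n)) \<longlonglongrightarrow> l * l ^ k"
      by (intro tendsto_mult Suc LIMSEQ_ignore_initial_segment[OF lim])
    then show ?case using nz by simp
  qed (simp add: nz)
  show ?thesis
  proof (cases m)
    case (nonneg k)
    then show ?thesis
      using fwd[of k] by (simp add: nat_int_add)
  next
    case (neg k')
    define k where "k = Suc k'"
    have m: "m = - int k" using neg k_def by simp
    have "(\<lambda>n. inverse (s (n + k) / s n)) \<longlonglongrightarrow> inverse (l ^ k)"
      using \<open>0 < l\<close> by (intro tendsto_inverse fwd) simp
    \<comment> \<open>At index \<open>n + k\<close> the shifted index is exactly \<open>n\<close>,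
      so truncation by \<open>nat\<close> never occurs; dropping the offset restores only finitely
      many terms.\<close>
    then have "(\<lambda>n. s (nat (int (n + k) + m)) / s (n + k)) \<longlonglongrightarrow> l powi m"
      using m by (simp add: power_int_minus)
    then show ?thesis by (rule LIMSEQ_offset)
  qed
qed

text \<open>A path of length \<open>m\<close> from \<open>y\<close> to \<open>x\<close> gives a
  lower bound uniform in \<open>n\<close>: going to \<open>x\<close> first and then surviving
  \<open>n\<close> steps is one way to survive \<open>m + n\<close> steps from \<open>y\<close>, and
  that is no likelier than surviving \<open>n\<close>.\<close>

lemma survival_ratio_limit_pos:
  fixes K :: "'s \<Rightarrow> 's \<Rightarrow> real"
  assumes inf: "infinite (UNIV :: 's set)" and sub: "substochastic K"
    and irr: "irreducible_kernel K"
    and lim: "(\<lambda>n. row_mass (kernel_pow K n) y / row_mass (kernel_pow K n) x) \<longlonglongrightarrow> c"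
  shows "0 < c"
proof -
  obtain m where m: "0 < kernel_pow K m y x"
    using irr by (auto simp: irreducible_kernel_def)
  have "kernel_pow K m y x \<le> row_mass (kernel_pow K n) y / row_mass (kernel_pow K n) x" for n
    using term_le_row_mass_kernel_pow_add[OF sub, of m y x n]
      row_mass_kernel_pow_antimono[OF sub, of n m y] row_mass_kernel_pow_pos[OF inf sub irr, of n x]
    by (simp add: pos_le_divide_eq add.commute)
  then have "kernel_pow K m y x \<le> c"
    by (intro LIMSEQ_le_const[OF lim]) auto
  with m show ?thesis by simp
qed

section \<open>Convergence norm, strong ratio limits and harmonicity\<close>

lemma convergence_parameter_eqI:
  assumes "\<And>x y. conv_radius (\<lambda>n. kernel_pow K n x y) = ereal R"
  shows "convergence_parameter K = R"
  unfolding convergence_parameter_def using assms by (intro the_equality) auto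

theorem proposition2p2:
  fixes K :: "'s::countable \<Rightarrow> 's \<Rightarrow> real" and x0 :: 's and hhat :: "'s \<Rightarrow> real"
  assumes "infinite (UNIV :: 's set)"
    and "substochastic K" and "irreducible_kernel K" and "aperiodic_kernel K"
    and "\<forall>x. \<exists>\<pi> :: 's pmf. \<forall>y.
           (\<lambda>n. kernel_pow K n x y / row_mass (kernel_pow K n) x) \<longlonglongrightarrow> pmf \<pi> y"
    and "\<forall>y. (\<lambda>n. row_mass (kernel_pow K n) y / row_mass (kernel_pow K n) x0) \<longlonglongrightarrow> hhat y"
  shows "generalized_SRLP K \<and> superharmonic K (convergence_norm K) hhat \<and>
         ((\<forall>x. finite {y. K x y \<noteq> 0}) \<longrightarrow> harmonic K (convergence_norm K) hhat)"
proof -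
  note basic = assms(1,2,3)
  note sub = assms(2)
  note pos = row_mass_kernel_pow_pos[OF basic]
  let ?S = "\<lambda>n. row_mass (kernel_pow K n)"
  have ratio: "(\<lambda>n. ?S n y / ?S n x0) \<longlonglongrightarrow> hhat y" for y
    using assms(6) by blast
  have hpos: "0 < hhat y" for y
    by (rule survival_ratio_limit_pos[OF basic ratio])
  obtain \<pi> where \<pi>: "\<And>x y. (\<lambda>n. kernel_pow K n x y / ?S n x) \<longlonglongrightarrow> pmf (\<pi> x) y"
    using assms(5) by metis
  have "\<exists>l. 0 < l \<and> (\<lambda>n. ?S (Suc n) x / ?S n x) \<longlonglongrightarrow> l \<and> invariant_qsd K l (\<pi> x)
    \<and> (\<forall>y. 0 < pmf (\<pi> x) y)" for x
    by (rule yaglom_limit[OF basic \<pi>, of x]) blast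
  then obtain r where r: "\<And>x. 0 < r x" "\<And>x. (\<lambda>n. ?S (Suc n) x / ?S n x) \<longlonglongrightarrow> r x"
      "\<And>x. invariant_qsd K (r x) (\<pi> x)" "\<And>x y. 0 < pmf (\<pi> x) y"
    by metis
  \<comment> \<open>The state \<open>x0\<close> serves as reference: comparing survival from
    \<open>x\<close> with survival from \<open>x0\<close> at times \<open>n\<close> and
    \<open>Suc n\<close> gives the same factor \<open>hhat x\<close>, which is positive and
    cancels.\<close>
  define l where "l = r x0"
  have r_eq: "r x = l" for x
  proof -
    have "(\<lambda>n. (?S (Suc n) x / ?S (Suc n) x0) * (?S (Suc n) x0 / ?S n x0) / (?S n x / ?S n x0))
      \<longlonglongrightarrow> hhat x * l / hhat x"
      unfolding l_def using hpos[of x]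
      by (intro tendsto_divide tendsto_mult r LIMSEQ_Suc[OF ratio] ratio) simp
    moreover have "(?S (Suc n) x / ?S (Suc n) x0) * (?S (Suc n) x0 / ?S n x0) / (?S n x / ?S n x0)
      = ?S (Suc n) x / ?S n x" for n
      using pos[of "Suc n" x0] pos[of n x0] by (simp del: kernel_pow.simps)
    ultimately have "(\<lambda>n. ?S (Suc n) x / ?S n x) \<longlonglongrightarrow> hhat x * l / hhat x"
      by (simp only:)
    then show ?thesis
      using LIMSEQ_unique[OF r(2)[of x]] hpos[of x] by simp
  qed
  have l: "0 < l" and rate: "\<And>x. (\<lambda>n. ?S (Suc n) x / ?S n x) \<longlonglongrightarrow> l"
    and qsd: "\<And>x. invariant_qsd K l (\<pi> x)"
    using r by (simp_all only: r_eq)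
  have SRLP_lim: "(\<lambda>n. kernel_pow K (nat (int n + m)) u v / kernel_pow K n x y)
      \<longlonglongrightarrow> l powi m * ((hhat u * pmf (\<pi> u) v) / (hhat x * pmf (\<pi> x) y))" for u v x y m
  proof -
    let ?m = "\<lambda>n. nat (int n + m)"
    have "filterlim ?m sequentially sequentially"
      unfolding filterlim_at_top
    proof
      fix Z
      show "eventually (\<lambda>n. Z \<le> ?m n) sequentially"
        using eventually_ge_at_top[of "Z + nat (- m)"] by eventually_elim linarith
    qed
    then have "(\<lambda>n. kernel_pow K (?m n) u v / ?S (?m n) u) \<longlonglongrightarrow> pmf (\<pi> u) v"
      using \<pi>[of u v] by (rule filterlim_compose[rotated])
    \<comment> \<open>The factors isolate in turn the conditional law from \<open>u\<close>, the
      time shift, and the change of starting state through \<open>x0\<close>; the denominator treats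
      \<open>x\<close> and \<open>y\<close> likewise.\<close>
    then have "(\<lambda>n. (kernel_pow K (?m n) u v / ?S (?m n) u) * (?S (?m n) u / ?S n u)
        * (?S n u / ?S n x0) / ((?S n x / ?S n x0) * (kernel_pow K n x y / ?S n x)))
      \<longlonglongrightarrow> pmf (\<pi> u) v * l powi m * hhat u / (hhat x * pmf (\<pi> x) y)"
      using hpos[of x] r(4)[of x y]
      by (intro tendsto_divide tendsto_mult \<pi> ratio tendsto_ratio_shift[OF pos rate l]) auto
    \<comment> \<open>Only row masses are cancelled. If \<open>kernel_pow K n x y\<close> is 0, both
      sides are 0 by the convention on division.\<close>
    moreover have "(kernel_pow K (?m n) u v / ?S (?m n) u) * (?S (?m n) u / ?S n u)
        * (?S n u / ?S n x0) / ((?S n x / ?S n x0) * (kernel_pow K n x y / ?S n x))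
      = kernel_pow K (?m n) u v / kernel_pow K n x y" for n
      using pos[of "?m n" u] pos[of n u] pos[of n x0] pos[of n x] by simp
    ultimately show ?thesis
      by (simp add: mult_ac)
  qed
  have "conv_radius (\<lambda>n. kernel_pow K n x y) = ereal (1 / l)" for x y
  proof (rule conv_radius_ratio_limit_nonzero[OF refl])
    show "1 / l \<noteq> 0" using l by simp
    \<comment> \<open>The ratio test uses each term over its successor, hence the inverse of the
      limit with shift 1 and equal pairs.\<close>
    have "(\<lambda>n. inverse (kernel_pow K (nat (int n + 1)) x y / kernel_pow K n x y)) \<longlonglongrightarrow> inverse l"
      using SRLP_lim[of 1 x y x y] hpos[of x] r(4)[of x y] l by (intro tendsto_inverse) auto
    moreover have "nat (int n + 1) = Suc n" for n by simp
    ultimately show "(\<lambda>n. norm (kernel_pow K n x y) / norm (kernel_pow K (Suc n) x y)) \<longlonglongrightarrow> 1 / l"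
      using substochastic_nonneg[OF substochastic_kernel_pow[OF sub]]
      by (simp add: inverse_eq_divide del: kernel_pow.simps)
  qed
  then have norm: "convergence_norm K = l"
    by (simp add: convergence_norm_def convergence_parameter_eqI)
  have "generalized_SRLP K"
    unfolding generalized_SRLP_def
  \<comment> \<open>With \<open>R = 1 / l\<close> the factor \<open>R powi (- m)\<close> is
    \<open>l powi m\<close>.\<close>
  proof (intro exI[of _ "1 / l"] exI[of _ hhat] exI[of _ \<pi>] conjI allI)
    show "(\<lambda>n. kernel_pow K (nat (int n + m)) u v / kernel_pow K n x y)
      \<longlonglongrightarrow> (1 / l) powi (- m) * ((hhat u * pmf (\<pi> u) v) / (hhat x * pmf (\<pi> x) y))" for u v x y m
      using SRLP_lim[of m u v x y]
      by (simp add: power_int_minus power_int_divide_distrib)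
  qed (use l qsd hpos norm in auto)
  have step: "(\<lambda>n. ?S (Suc n) x / ?S n x0) \<longlonglongrightarrow> l * hhat x" for x
  proof -
    have "(\<lambda>n. ?S (Suc n) x / ?S n x * (?S n x / ?S n x0)) \<longlonglongrightarrow> l * hhat x"
      by (intro tendsto_mult rate ratio)
    moreover have "?S (Suc n) x / ?S n x * (?S n x / ?S n x0) = ?S (Suc n) x / ?S n x0" for n
      using pos[of n x] by (simp del: kernel_pow.simps)
    ultimately show ?thesis by (simp only:)
  qed
  have S_Suc: "?S (Suc n) x = (\<Sum>\<^sub>\<infinity>y. K x y * ?S n y)" for n x
    using row_mass_kernel_pow_add[OF sub, of 1 n x]
    unfolding kernel_pow_1[OF sub] by (simp del: kernel_pow.simps)
  have partial_lim: "(\<lambda>n. (\<Sum>y\<in>F. K x y * ?S n y) / ?S n x0) \<longlonglongrightarrow> (\<Sum>y\<in>F. K x y * hhat y)" for F x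
  proof -
    have "(\<lambda>n. \<Sum>y\<in>F. K x y * (?S n y / ?S n x0)) \<longlonglongrightarrow> (\<Sum>y\<in>F. K x y * hhat y)"
      by (intro tendsto_sum tendsto_mult tendsto_const ratio)
    then show ?thesis by (simp add: sum_divide_distrib)
  qed
  \<comment> \<open>Fatou on finite sets: the partial sums are bounded before the limit by
    \<open>S_Suc\<close>. The bound, uniform in \<open>F\<close>, yields summability as well as
    superharmonicity.\<close>
  have partial_le: "(\<Sum>y\<in>F. K x y * hhat y) \<le> l * hhat x" if "finite F" for F x
  proof (rule LIMSEQ_le[OF partial_lim step], intro exI allI impI)
    fix n
    have "(\<Sum>y\<in>F. K x y * ?S n y) \<le> ?S (Suc n) x"
      unfolding S_Suc
      by (intro finite_sum_le_infsum summable_on_mult_bounded that)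
        (auto simp: sub substochastic_kernel_pow substochastic_nonneg substochastic_summable
          substochastic_mass_le_1 row_mass_nonneg)
    then show "(\<Sum>y\<in>F. K x y * ?S n y) / ?S n x0 \<le> ?S (Suc n) x / ?S n x0"
      by (intro divide_right_mono less_imp_le[OF pos])
  qed
  have nonneg: "0 \<le> K x y * hhat y" for x y
    by (intro mult_nonneg_nonneg substochastic_nonneg sub less_imp_le hpos)
  have summable: "(\<lambda>y. K x y * hhat y) summable_on UNIV" for x
    by (rule nonneg_bdd_above_summable_on[OF nonneg]) (auto intro!: bdd_aboveI2 partial_le)
  have super: "superharmonic K l hhat"
    unfolding superharmonic_def
    by (auto intro!: less_imp_le[OF hpos] summable infsum_le_finite_sums partial_le)
  have "harmonic K l hhat" if fin: "\<forall>x. finite {y. K x y \<noteq> 0}"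
    unfolding harmonic_def
  proof (intro conjI super allI)
    fix x
    let ?F = "{y. K x y \<noteq> 0}"
    \<comment> \<open>Finite support turns the full sum into one fixed partial sum, so
      \<open>partial_lim\<close> and \<open>step\<close> give two limits of the same
      sequence.\<close>
    have collapse: "(\<Sum>\<^sub>\<infinity>y. K x y * g y) = (\<Sum>y\<in>?F. K x y * g y)" for g
      using fin by (intro infsumI has_sum_finite_neutralI[where B = ?F]) auto
    show "(\<Sum>\<^sub>\<infinity>y. K x y * hhat y) = l * hhat x"
      using LIMSEQ_unique[OF partial_lim[of x ?F] step[of x, unfolded S_Suc collapse]]
      by (simp only: collapse)
  qed
  with \<open>generalized_SRLP K\<close> super show ?thesis
    unfolding norm by blast
qed

end
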